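(* Let $q\in\mathbb{N}$ be fixed. Suppose that $\langle N\rangle\to\infty$, that $\langle M\rangle^{-1}=O(1)$ (i.e. $\langle M\rangle$ is bounded away from zero), and that $\kappa:=\langle M\rangle^{q+1}/\langle N\rangle\to 0$. Then the roots $z_1,z_2$ of the system of equations $\mathsf{E}_{\boldsymbol z}(N_\lambda)=\langle N\rangle$, $\mathsf{E}_{\boldsymbol z}(M_\lambda)=\langle M\rangle$ are asymptotically given by $$z_1=\exp\left(-\frac{\langle M\rangle}{q\,\langle N\rangle}\bigl(1+O(\kappa^{1/q})\bigr)\right),\qquad z_2=\frac{\kappa^{1/q}}{q^{1/q}\,\Gamma(1+1/q)}\bigl(1+O(\kappa^{1/q})\bigr).$$
   Context: $\mathbb{N}=\{1,2,\dots\}$, $\mathbb{N}^q=\{j^q: j\in\mathbb{N}\}$. $\check{\Lambda}^q$ is the set of all strict integer partitions into $q$-th powers, i.e. finite (possibly empty) sequences $\lambda_1>\lambda_2>\cdots$ of distinct elements of $\mathbb{N}^q$. For $\lambda\in\check\Lambda^q$ and $\ell\in\mathbb{N}^q$, $\nu_\ell\in\{0,1\}$ is the multiplicity of the part $\ell$ in $\lambda$; the weight is $N_\lambda=\sum_{\ell\in\mathbb{N}^q}\ell\nu_\ell$ and the length is $M_\lambda=\sum_{\ell\in\mathbb{N}^q}\nu_\ell$. For $\boldsymbol z=(z_1,z_2)$ with $0<z_1<1$, $z_2>0$, the Boltzmann distribution on $\check\Lambda^q$ is $\mathsf{P}_{\boldsymbol z}(\lambda)=z_1^{N_\lambda}z_2^{M_\lambda}/F(\boldsymbol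 z)$, where $F(\boldsymbol z)=\sum_{\lambda\in\check\Lambda^q}z_1^{N_\lambda}z_2^{M_\lambda}$; $\mathsf{E}_{\boldsymbol z}$ is the corresponding expectation. The hyper-parameters $\langle N\rangle,\langle M\rangle$ are positive real numbers, varying along a family in the stated limit. *)

theory Defs
  imports "HOL-Probability.Probability" "HOL-Library.Landau_Symbols"
begin

definition qth_powers :: "nat \<Rightarrow> nat set" where
  "qth_powers q = {j ^ q |j. 1 \<le> j}"

definition strict_partitions :: "nat \<Rightarrow> nat list set" where
  "strict_partitions q = {ps. sorted_wrt (>) ps \<and> set ps \<subseteq> qth_powers q}"

text \<open>
  The multiplicity of a part \<open>l\<close> in \<open>ps\<close> is \<open>count_list ps l\<close>. The sums below range over the parts
  that occur; all other multiplicities vanish.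
\<close>

definition weight :: "nat list \<Rightarrow> nat" where
  "weight ps = (\<Sum>l\<in>set ps. l * count_list ps l)"

definition num_parts :: "nat list \<Rightarrow> nat" where
  "num_parts ps = (\<Sum>l\<in>set ps. count_list ps l)"

lemma weight_eq_sum_list: "weight ps = sum_list ps"
  using sum_list_map_eq_sum_count[of "\<lambda>x. x" ps] by (simp add: weight_def mult.commute)

lemma num_parts_eq_length: "num_parts ps = length ps"
  by (simp add: num_parts_def sum_count_set)

definition boltzmann_weight :: "real \<times> real \<Rightarrow> nat list \<Rightarrow> real" where
  "boltzmann_weight z ps = fst z ^ weight ps * snd z ^ num_parts ps"

definition partition_function :: "nat \<Rightarrow> real \<times> real \<Rightarrow> real" where
  "partition_function q z = (\<Sum>\<^sub>\<infinity>ps\<in>strict_partitions q. boltzmann_weight z ps)"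

definition boltzmann :: "nat \<Rightarrow> real \<times> real \<Rightarrow> nat list measure" where
  "boltzmann q z =
     point_measure (strict_partitions q) (\<lambda>ps. ennreal (boltzmann_weight z ps / partition_function q z))"

definition calibration_root :: "nat \<Rightarrow> real \<Rightarrow> real \<Rightarrow> real \<times> real \<Rightarrow> bool" where
  "calibration_root q n m z \<longleftrightarrow>
     0 < fst z \<and> fst z < 1 \<and> 0 < snd z \<and>
     (\<integral>ps. real (weight ps) \<partial>boltzmann q z) = n \<and>
     (\<integral>ps. real (num_parts ps) \<partial>boltzmann q z) = m"

end

theory Submission imports Defs begin

text \<open>
  Write \<open>z1 = exp (- a)\<close>. Under the Boltzmann distribution the parts occur independently, so the two
  equations become \<open>\<Sum>l. l ^ k * p l = N\<close> (\<open>k = 1\<close>) and \<open>= M\<close> (\<open>k = 0\<close>), where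
  \<open>p l = z2 * exp (- a * l) / (1 + z2 * exp (- a * l))\<close> and \<open>l\<close> ranges over the \<open>q\<close>-th powers.
  As \<open>p l\<close> equals \<open>z2 * exp (- a * l)\<close> up to a factor between \<open>1 / (1 + z2)\<close> and \<open>1\<close>, and the sum
  of \<open>l ^ k * exp (- a * l)\<close> is a Gamma integral up to \<open>O(a ^ (- k))\<close>, both sides are known up to a
  factor \<open>1 + O(a ^ (1 / q) + z2)\<close>.

  Roots are unique by a monotonicity argument. It therefore suffices to construct one root with the
  claimed asymptotics: for \<open>a\<close> between half and twice the predicted value the second equation is solved
  by a small \<open>z2\<close> depending continuously on \<open>a\<close>, and the intermediate value theorem then solves the
  first one. So no a priori bounds on an arbitrary root are needed.
\<close>

section \<open>Sums over powers and Gamma integrals\<close>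

text \<open>On each unit interval the mean value theorem turns the increment of \<open>P\<close>
  into a value of \<open>f\<close>; its distance to the value at the right endpoint is paid for by
  the growth of \<open>g\<close>, and these costs telescope. Differentiability is asked only at
  positive points because \<open>P\<close> will be built from an integral that may be singular at
  0.\<close>

lemma sum_minus_antiderivative_bound:
  fixes f g P :: "real \<Rightarrow> real"
  assumes cont: "continuous_on {0..} P"
    and deriv: "\<And>x. 0 < x \<Longrightarrow> (P has_real_derivative f x) (at x)"
    and var: "\<And>x y. 0 \<le> x \<Longrightarrow> x \<le> y \<Longrightarrow> \<bar>f y - f x\<bar> \<le> g y - g x"
  shows "\<bar>(\<Sum>j<n. f (real (Suc j))) - (P (real n) - P 0)\<bar> \<le> g (real n) - g 0"
proof (induction n)
  case 0
  then show ?case by simp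
next
  case (Suc n)
  have "\<exists>l z. real n < z \<and> z < real (Suc n) \<and> (P has_real_derivative l) (at z) \<and>
      P (real (Suc n)) - P (real n) = (real (Suc n) - real n) * l"
  proof (rule MVT)
    show "continuous_on {real n..real (Suc n)} P"
      by (rule continuous_on_subset[OF cont]) auto
    show "P differentiable (at x)" if "real n < x" for x
      using deriv[of x] that real_differentiable_def by (meson le_less_trans of_nat_0_le_iff)
  qed simp
  then obtain l z where z: "real n < z" "z < real (Suc n)" "(P has_real_derivative l) (at z)"
    and l: "P (real (Suc n)) - P (real n) = l"
    by auto
  have "l = f z"
    using z(1,3) deriv[of z] DERIV_unique by (meson le_less_trans of_nat_0_le_iff)
  moreover have "\<bar>f (real (Suc n)) - f z\<bar> \<le> g (real (Suc n)) - g z"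
    using z by (intro var) auto
  \<comment> \<open>\<open>var\<close> forces \<open>g\<close> to be nondecreasing, so the bound
    over \<open>{z..n + 1}\<close> extends to all of \<open>{n..n + 1}\<close>.\<close>
  moreover have "0 \<le> g z - g (real n)"
    using var[of "real n" z] z by simp
  ultimately show ?case
    using Suc.IH l by simp
qed

text \<open>
  The right-hand side is the integral of \<open>(1 + t) * exp (- t)\<close> over \<open>{x..y}\<close>, and this integrand dominates
  the absolute value of the derivative of \<open>t ^ k * exp (- t)\<close> for both \<open>k = 0\<close> and \<open>k = 1\<close>.
\<close>

lemma power_exp_variation:
  fixes x y :: real
  assumes "k \<le> 1" "0 \<le> x" "x \<le> y"
  shows "\<bar>y ^ k * exp (- y) - x ^ k * exp (- x)\<bar> \<le> (2 + x) * exp (- x) - (2 + y) * exp (- y)"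
proof -
  \<comment> \<open>Each of the two inequalities behind the absolute value rearranges to the
    decrease of \<open>(b + c * t) * exp (- t)\<close>: with \<open>(b, c)\<close> equal to
    \<open>(1, 1)\<close> and \<open>(3, 1)\<close> for \<open>k = 0\<close>, and to
    \<open>(2, 0)\<close> and \<open>(2, 2)\<close> for \<open>k = 1\<close>.\<close>
  have affine: "(b + c * y) * exp (- y) \<le> (b + c * x) * exp (- x)" if "0 \<le> c" "c \<le> b" for b c :: real
  proof (rule DERIV_nonpos_imp_nonincreasing[OF assms(3)])
    fix t assume t: "x \<le> t" "t \<le> y"
    have "((\<lambda>y. (b + c * y) * exp (- y)) has_real_derivative - ((b - c + c * t) * exp (- t))) (at t)"
      by (auto intro!: derivative_eq_intros simp: algebra_simps)
    moreover have "0 \<le> (b - c + c * t) * exp (- t)"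
      using that t assms by simp
    ultimately show "\<exists>d. ((\<lambda>y. (b + c * y) * exp (- y)) has_real_derivative d) (at t) \<and> d \<le> 0"
      by (intro exI[of _ "- ((b - c + c * t) * exp (- t))"]) simp
  qed
  consider "k = 0" | "k = 1" using assms by linarith
  then show ?thesis
  proof cases
    case 1
    with affine[of 1 1] affine[of 1 3] show ?thesis by (simp add: algebra_simps abs_le_iff)
  next
    case 2
    have "2 * exp (- y) \<le> 2 * exp (- x)" "(2 + 2 * y) * exp (- y) \<le> (2 + 2 * x) * exp (- x)"
      using affine[of 0 2] affine[of 2 2] by simp_all
    then show ?thesis
      unfolding 2 power_one_right distrib_right mult.assoc by linarith
  qed
qed

section \<open>The incomplete Gamma function: limit, continuity, derivative\<close>

lemma incomplete_Gamma_tendsto: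
  fixes s :: real
  assumes "0 < s"
  shows "((\<lambda>y. integral {0..y} (\<lambda>t. t powr (s - 1) / exp t)) \<longlongrightarrow> Gamma s) at_top"
proof (rule tendstoI)
  fix e :: real assume "e > 0"
  define f where "f = (\<lambda>t::real. t powr (s - 1) / exp t)"
  have "(f has_integral Gamma s) {0..}"
    unfolding f_def by (rule Gamma_integral_real[OF assms])
  then obtain B where B: "B > 0"
    "\<And>a b. ball 0 B \<subseteq> cbox a b \<Longrightarrow>
      norm (integral (cbox a b) (\<lambda>x. if x \<in> {0..} then f x else 0) - Gamma s) < e"
    unfolding has_integral_alt' using \<open>e > 0\<close> by meson
  show "\<forall>\<^sub>F y in at_top. dist (integral {0..y} (\<lambda>t. t powr (s - 1) / exp t)) (Gamma s) < e"
  proof (rule eventually_mono[OF eventually_ge_at_top[of B]])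
    fix y assume y: "B \<le> y"
    \<comment> \<open>The integral over the unbounded set is tested on boxes containing a large
      ball; cutting the integrand off to 0 on negative numbers leaves only
      \<open>{0..y}\<close>.\<close>
    have "ball 0 B \<subseteq> cbox (- y) y" using y by (auto simp: dist_real_def)
    from B(2)[OF this]
    have "\<bar>integral {- y..y} (\<lambda>x. if x \<in> {0..} then f x else 0) - Gamma s\<bar> < e" by simp
    also have "integral {- y..y} (\<lambda>x. if x \<in> {0..} then f x else 0) = integral ({- y..y} \<inter> {0..}) f"
      using integral_restrict_Int[of "{- y..y}" "{0..}" f] by (simp add: Int_commute)
    also have "{- y..y} \<inter> {0..} = {0..y}" using y B(1) by auto
    finally show "dist (integral {0..y} (\<lambda>t. t powr (s - 1) / exp t)) (Gamma s) < e"
      by (simp add: dist_real_def f_def)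
  qed
qed

lemma Gamma_integrand_integrable:
  fixes s :: real
  assumes "0 < s"
  shows "(\<lambda>t. t powr (s - 1) / exp t) integrable_on {0..b}"
proof (rule integrable_on_subinterval)
  show "(\<lambda>t. t powr (s - 1) / exp t) integrable_on {0..}"
    using Gamma_integral_real[OF assms] by blast
qed auto

text \<open>For \<open>s < 1\<close> the integrand is unbounded near 0, so continuity up to 0 is
  drawn from integrability and not from the derivative.\<close>

lemma incomplete_Gamma_continuous:
  fixes s :: real
  assumes "0 < s"
  shows "continuous_on {0..} (\<lambda>y. integral {0..y} (\<lambda>t. t powr (s - 1) / exp t))"
  unfolding continuous_on_eq_continuous_within
proof
  fix x :: real assume x: "x \<in> {0..}"
  have "continuous (at x within {0..x + 1}) (\<lambda>y. integral {0..y} (\<lambda>t. t powr (s - 1) / exp t))"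
    using indefinite_integral_continuous_1[OF Gamma_integrand_integrable[OF assms, of "x + 1"]] x
    by (auto simp: continuous_on_eq_continuous_within)
  moreover have "at x within {0..x + 1} = at x within {0..}"
    by (rule at_within_nhd[of _ "{..<x + 1}"]) auto
  ultimately show "continuous (at x within {0..}) (\<lambda>y. integral {0..y} (\<lambda>t. t powr (s - 1) / exp t))"
    by simp
qed

lemma incomplete_Gamma_deriv:
  fixes s x :: real
  assumes "0 < s" "0 < x"
  shows "((\<lambda>y. integral {0..y} (\<lambda>t. t powr (s - 1) / exp t)) has_real_derivative
     x powr (s - 1) / exp x) (at x)"
proof -
  have "((\<lambda>y. integral {0..y} (\<lambda>t. t powr (s - 1) / exp t)) has_vector_derivative
     x powr (s - 1) / exp x) (at x within {0..x + 1})"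
  proof (rule integral_has_vector_derivative_continuous_at[where S = "{}", simplified])
    show "(\<lambda>t. t powr (s - 1) / exp t) integrable_on {0..x + 1}"
      by (rule Gamma_integrand_integrable[OF assms(1)])
    show "continuous (at x within {0..x + 1}) (\<lambda>t. t powr (s - 1) / exp t)"
      using assms by (intro continuous_intros) auto
  qed (use assms in auto)
  moreover have "at x within {0..x + 1} = at x"
    using assms by (intro at_within_interior) auto
  ultimately show ?thesis
    by (simp add: has_real_derivative_iff_has_vector_derivative)
qed

text \<open>The substitution \<open>t = a * x ^ q\<close> in the Gamma integral yields an explicit
  antiderivative of the summand; \<open>s\<close> is the exponent that it dictates.\<close>

lemma incomplete_Gamma_substitution_deriv:
  fixes a x :: real and k :: nat
  assumes q: "1 \<le> q" and a: "0 < a" and x: "0 < x"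
  defines "s \<equiv> real k + 1 / real q"
  shows "((\<lambda>x. integral {0..a * x ^ q} (\<lambda>t. t powr (s - 1) / exp t) / (real q * a powr s))
     has_real_derivative (x ^ q) ^ k * exp (- (a * x ^ q))) (at x)"
proof -
  have s: "0 < s" using q by (simp add: s_def add_nonneg_pos)
  have ax: "0 < a * x ^ q" using a x by simp
  have "((\<lambda>x. integral {0..a * x ^ q} (\<lambda>t. t powr (s - 1) / exp t)) has_real_derivative
      (a * x ^ q) powr (s - 1) / exp (a * x ^ q) * (a * (real q * x ^ (q - 1)))) (at x)"
    by (rule DERIV_chain2[where f = "\<lambda>y. integral {0..y} (\<lambda>t. t powr (s - 1) / exp t)"
          and g = "\<lambda>x. a * x ^ q", OF incomplete_Gamma_deriv[OF s ax]])
       (auto intro!: derivative_eq_intros)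
  then have "((\<lambda>x. integral {0..a * x ^ q} (\<lambda>t. t powr (s - 1) / exp t) / (real q * a powr s))
     has_real_derivative (a * x ^ q) powr (s - 1) / exp (a * x ^ q) * (a * (real q * x ^ (q - 1)))
        / (real q * a powr s)) (at x)"
    by (rule DERIV_cdivide)
  moreover have "(a * x ^ q) powr (s - 1) / exp (a * x ^ q) * (a * (real q * x ^ (q - 1)))
        / (real q * a powr s) = (x ^ q) ^ k * exp (- (a * x ^ q))"
  proof -
    \<comment> \<open>The exponent \<open>q * (s - 1)\<close> from the integrand and
      \<open>q - 1\<close> from the inner derivative add up to \<open>q * k\<close>.\<close>
    have e: "real q * (s - 1) + (real q - 1) = real q * real k"
      using q by (simp add: s_def field_simps)
    have "(a * x ^ q) powr (s - 1) = a powr s / a * x powr (real q * (s - 1))"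
    proof -
      have "a powr (s - 1) = a powr s / a" using a by (simp add: powr_diff)
      then show ?thesis using a x by (simp add: powr_mult powr_powr flip: powr_realpow)
    qed
    moreover have "x ^ (q - 1) = x powr (real q - 1)"
      using x q by (simp add: of_nat_diff flip: powr_realpow)
    moreover have "(x ^ q) ^ k = x powr (real q * (s - 1)) * x powr (real q - 1)"
      using x by (simp only: e powr_add[symmetric]) (simp add: powr_powr flip: powr_realpow)
    ultimately show ?thesis
      using a q by (simp add: exp_minus field_simps)
  qed
  ultimately show ?thesis by simp
qed

text \<open>The case \<open>k = 0\<close> will serve the length and \<open>k = 1\<close> the
  weight.\<close>

definition power_exp_sum :: "nat \<Rightarrow> nat \<Rightarrow> real \<Rightarrow> real" where
  "power_exp_sum q k a = (\<Sum>j. (real (Suc j) ^ q) ^ k * exp (- (a * real (Suc j) ^ q)))"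

text \<open>The dominating function \<open>g\<close> climbs from \<open>- 2 / a ^ k\<close> to at
  most 0, which bounds the error uniformly in the number of terms. Against the main term this error
  has relative order \<open>a powr (1 / q)\<close>. The same bound on partial sums gives
  summability.\<close>

lemma power_exp_sum_asymp:
  fixes a :: real
  assumes q: "1 \<le> q" and k: "k \<le> 1" and a: "0 < a"
  defines "s \<equiv> real k + 1 / real q"
  shows summable_power_exp: "summable (\<lambda>j. (real (Suc j) ^ q) ^ k * exp (- (a * real (Suc j) ^ q)))"
    and power_exp_sum_bound: "\<bar>power_exp_sum q k a - Gamma s / (real q * a powr s)\<bar> \<le> 2 / a ^ k"
proof -
  define I where "I = (\<lambda>y. integral {0..y} (\<lambda>t. t powr (s - 1) / exp t))"
  define f where "f = (\<lambda>x::real. (x ^ q) ^ k * exp (- (a * x ^ q)))"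
  define g where "g = (\<lambda>x::real. - ((2 + a * x ^ q) * exp (- (a * x ^ q)) / a ^ k))"
  define P where "P = (\<lambda>x::real. I (a * x ^ q) / (real q * a powr s))"
  have s: "0 < s" using q by (simp add: s_def add_nonneg_pos)
  have "continuous_on {0..} P"
    unfolding P_def I_def using a q
    by (intro continuous_intros continuous_on_compose2[OF incomplete_Gamma_continuous[OF s]]) auto
  moreover have "(P has_real_derivative f x) (at x)" if "0 < x" for x
    unfolding P_def f_def I_def s_def by (rule incomplete_Gamma_substitution_deriv[OF q a that])
  moreover have "\<bar>f y - f x\<bar> \<le> g y - g x" if "0 \<le> x" "x \<le> y" for x y
  proof -
    have f': "f x = (a * x ^ q) ^ k * exp (- (a * x ^ q)) / a ^ k" for x
      using a by (simp add: f_def power_mult_distrib)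
    have "\<bar>(a * y ^ q) ^ k * exp (- (a * y ^ q)) - (a * x ^ q) ^ k * exp (- (a * x ^ q))\<bar>
       \<le> (2 + a * x ^ q) * exp (- (a * x ^ q)) - (2 + a * y ^ q) * exp (- (a * y ^ q))"
      using a that by (intro power_exp_variation[OF k]) (auto intro!: mult_left_mono power_mono)
    then show ?thesis
      using a by (simp add: f' g_def divide_right_mono flip: diff_divide_distrib)
  qed
  ultimately have "\<bar>(\<Sum>j<n. f (real (Suc j))) - (P (real n) - P 0)\<bar> \<le> g (real n) - g 0" for n
    by (rule sum_minus_antiderivative_bound)
  moreover have "g (real n) \<le> 0" "g 0 = - (2 / a ^ k)" "P 0 = 0" for n
    using a q by (auto simp: g_def P_def I_def power_0_left)
  ultimately have bound: "\<bar>(\<Sum>j<n. f (real (Suc j))) - P (real n)\<bar> \<le> 2 / a ^ k" for n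
    by (smt (verit))
  have "filterlim (\<lambda>n. a * real n ^ q) at_top sequentially"
    using a q by (intro filterlim_tendsto_pos_mult_at_top[OF tendsto_const]
        filterlim_pow_at_top filterlim_real_sequentially) auto
  then have Plim: "(\<lambda>n. P (real n)) \<longlonglongrightarrow> Gamma s / (real q * a powr s)"
    unfolding P_def I_def using a q
    by (intro tendsto_divide filterlim_compose[OF incomplete_Gamma_tendsto[OF s]] tendsto_const) auto
  then obtain B where B: "\<And>n. \<bar>P (real n)\<bar> \<le> B"
    using convergent_imp_Bseq[of "\<lambda>n. P (real n)"] by (auto simp: Bseq_def convergent_def)
  have f0: "0 \<le> f x" if "0 \<le> x" for x using that by (simp add: f_def)
  have summ: "summable (\<lambda>j. f (real (Suc j)))"
  proof (rule summableI_nonneg_bounded)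
    show "(\<Sum>j<n. f (real (Suc j))) \<le> B + 2 / a ^ k" for n
      using B[of n] bound[of n] by linarith
  qed (rule f0, simp)
  then show "summable (\<lambda>j. (real (Suc j) ^ q) ^ k * exp (- (a * real (Suc j) ^ q)))"
    by (simp add: f_def)
  have "(\<lambda>n. \<bar>(\<Sum>j<n. f (real (Suc j))) - P (real n)\<bar>) \<longlonglongrightarrow>
      \<bar>power_exp_sum q k a - Gamma s / (real q * a powr s)\<bar>"
    using summable_LIMSEQ[OF summ] Plim unfolding power_exp_sum_def f_def
    by (intro tendsto_rabs tendsto_diff)
  then show "\<bar>power_exp_sum q k a - Gamma s / (real q * a powr s)\<bar> \<le> 2 / a ^ k"
    by (rule LIMSEQ_le_const2) (use bound in auto)
qed

section \<open>Expectations under the Boltzmann distribution\<close>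

definition finite_subsets :: "'a set \<Rightarrow> 'a set set" where
  "finite_subsets L = {A. finite A \<and> A \<subseteq> L}"

text \<open>Finitely many finite subsets lie in the power set of their union, over which the weights
  sum to a product of factors \<open>w l + 1\<close>, each at most \<open>exp (w l)\<close>.\<close>

lemma summable_on_prod_finite_subsets:
  fixes w :: "'a \<Rightarrow> real"
  assumes nonneg: "\<And>l. l \<in> L \<Longrightarrow> 0 \<le> w l" and summable: "w summable_on L"
  shows "(\<lambda>A. \<Prod>l\<in>A. w l) summable_on finite_subsets L"
proof (rule nonneg_bdd_above_summable_on)
  show "0 \<le> (\<Prod>l\<in>A. w l)" if "A \<in> finite_subsets L" for A
    using that nonneg by (auto simp: finite_subsets_def intro!: prod_nonneg)
  have "(\<Sum>A\<in>S. \<Prod>l\<in>A. w l) \<le> exp (infsum w L)" if S: "S \<subseteq> finite_subsets L" "finite S" for S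
  proof -
    have fin: "finite (\<Union>S)" and sub: "\<Union>S \<subseteq> L"
      using S by (auto simp: finite_subsets_def)
    have "(\<Sum>A\<in>S. \<Prod>l\<in>A. w l) \<le> (\<Sum>A\<in>Pow (\<Union>S). \<Prod>l\<in>A. w l)"
      using fin sub nonneg by (intro sum_mono2) (auto 4 4 intro!: prod_nonneg)
    also have "\<dots> = (\<Prod>l\<in>\<Union>S. w l + 1)"
      by (simp add: prod_add[OF fin])
    also have "\<dots> \<le> (\<Prod>l\<in>\<Union>S. exp (w l))"
      using nonneg sub by (intro prod_mono) (auto simp: add.commute intro: add_nonneg_nonneg)
    also have "\<dots> = exp (sum w (\<Union>S))"
      by (simp add: exp_sum[OF fin])
    also have "\<dots> \<le> exp (infsum w L)"
      using finite_sum_le_infsum[OF summable fin sub] nonneg by simp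
    finally show ?thesis .
  qed
  then show "bdd_above (sum (\<lambda>A. \<Prod>l\<in>A. w l) ` {S. S \<subseteq> finite_subsets L \<and> finite S})"
    by (intro bdd_aboveI2[of _ _ "exp (infsum w L)"]) auto
qed

text \<open>Inserting \<open>l\<close> maps the sets without \<open>l\<close> bijectively onto those
  with \<open>l\<close> and multiplies the weight by \<open>w l\<close>; the two classes thus have
  total weights in the ratio \<open>1 : w l\<close>. Values in \<open>ennreal\<close> avoid any
  summability hypothesis.\<close>

lemma nn_integral_prod_finite_subsets_member:
  fixes w :: "'a \<Rightarrow> real"
  assumes nonneg: "\<And>l. l \<in> L \<Longrightarrow> 0 \<le> w l" and l: "l \<in> L"
  shows "(\<integral>\<^sup>+A. ennreal (\<Prod>l\<in>A. w l) * indicator {A. l \<in> A} A \<partial>count_space (finite_subsets L)) =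
    ennreal (w l / (1 + w l)) * (\<integral>\<^sup>+A. ennreal (\<Prod>l\<in>A. w l) \<partial>count_space (finite_subsets L))"
proof -
  define W where "W = (\<lambda>A. ennreal (\<Prod>l\<in>A. w l))"
  define X where "X = {A \<in> finite_subsets L. l \<in> A}"
  define Y where "Y = {A \<in> finite_subsets L. l \<notin> A}"
  have wl: "0 \<le> w l" using nonneg l by simp
  have "bij_betw (insert l) Y X"
    by (rule bij_betwI[where g = "\<lambda>A. A - {l}"]) (use l in \<open>auto simp: X_def Y_def finite_subsets_def\<close>)
  then have "(\<integral>\<^sup>+A. W A \<partial>count_space X) = (\<integral>\<^sup>+A. W (insert l A) \<partial>count_space Y)"
    by (rule nn_integral_bij_count_space[symmetric])
  also have "\<dots> = (\<integral>\<^sup>+A. ennreal (w l) * W A \<partial>count_space Y)"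
  proof (rule nn_integral_cong)
    fix A assume "A \<in> space (count_space Y)"
    then show "W (insert l A) = ennreal (w l) * W A"
      using wl by (simp add: W_def Y_def finite_subsets_def ennreal_mult')
  qed
  also have "\<dots> = ennreal (w l) * (\<integral>\<^sup>+A. W A \<partial>count_space Y)"
    by (rule nn_integral_cmult) simp
  finally have IX: "(\<integral>\<^sup>+A. W A \<partial>count_space X) = ennreal (w l) * (\<integral>\<^sup>+A. W A \<partial>count_space Y)" .
  have "finite_subsets L = X \<union> Y" "X \<inter> Y = {}"
    by (auto simp: X_def Y_def)
  then have "(\<integral>\<^sup>+A. W A \<partial>count_space (finite_subsets L)) =
      (\<integral>\<^sup>+A. W A \<partial>count_space X) + (\<integral>\<^sup>+A. W A \<partial>count_space Y)"
    by (simp add: nn_integral_count_space_indicator nn_integral_disjoint_pair_countspace)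
  also have "\<dots> = ennreal (1 + w l) * (\<integral>\<^sup>+A. W A \<partial>count_space Y)"
    using wl by (simp add: IX ennreal_plus distrib_right add.commute del: ennreal_plus[symmetric])
  finally have I: "(\<integral>\<^sup>+A. W A \<partial>count_space (finite_subsets L)) =
      ennreal (1 + w l) * (\<integral>\<^sup>+A. W A \<partial>count_space Y)" .
  have "(\<integral>\<^sup>+A. W A * indicator {A. l \<in> A} A \<partial>count_space (finite_subsets L)) =
      (\<integral>\<^sup>+A. W A \<partial>count_space X)"
    by (auto simp: nn_integral_count_space_indicator X_def indicator_def intro!: nn_integral_cong)
  also have "\<dots> = ennreal (w l / (1 + w l)) * (\<integral>\<^sup>+A. W A \<partial>count_space (finite_subsets L))"
  proof -
    have "ennreal (w l / (1 + w l)) * ennreal (1 + w l) = ennreal (w l)"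
      using wl by (simp add: add_nonneg_nonneg del: ennreal_plus flip: ennreal_mult')
    then show ?thesis unfolding IX I by (simp only: mult.assoc[symmetric])
  qed
  finally show ?thesis
    by (simp add: W_def)
qed

text \<open>An additive statistic is a series of membership indicators, integrated term by term. The
  enumeration \<open>e\<close> turns the sum over \<open>L\<close> into such a series.\<close>

lemma nn_integral_prod_finite_subsets_additive:
  fixes w c :: "'a \<Rightarrow> real" and e :: "nat \<Rightarrow> 'a"
  assumes nonneg: "\<And>l. l \<in> L \<Longrightarrow> 0 \<le> w l" "\<And>l. l \<in> L \<Longrightarrow> 0 \<le> c l"
    and e: "bij_betw e UNIV L"
  shows "(\<integral>\<^sup>+A. ennreal (\<Prod>l\<in>A. w l) * ennreal (\<Sum>l\<in>A. c l) \<partial>count_space (finite_subsets L)) =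
    (\<Sum>j. ennreal (c (e j) * (w (e j) / (1 + w (e j))))) *
      (\<integral>\<^sup>+A. ennreal (\<Prod>l\<in>A. w l) \<partial>count_space (finite_subsets L))"
proof -
  define W where "W = (\<lambda>A. ennreal (\<Prod>l\<in>A. w l))"
  have eL: "e j \<in> L" for j using e by (auto simp: bij_betw_def)
  have "ennreal (\<Sum>l\<in>A. c l) = (\<Sum>j. ennreal (c (e j)) * indicator {A. e j \<in> A} A)"
    if A: "A \<in> finite_subsets L" for A
  proof -
    have "A \<subseteq> range e" using A e by (auto simp: finite_subsets_def bij_betw_def)
    then have A': "e ` (e -` A) = A" by auto
    have inj: "inj e" using e by (auto simp: bij_betw_def)
    have fin: "finite (e -` A)"
      using A inj by (auto simp: finite_subsets_def intro: finite_vimageI)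
    have "(\<Sum>l\<in>A. c l) = (\<Sum>j\<in>e -` A. c (e j))"
      using sum.reindex[of e "e -` A" c] inj A' by (simp add: inj_on_subset)
    then have "ennreal (\<Sum>l\<in>A. c l) = (\<Sum>j\<in>e -` A. ennreal (c (e j)))"
      using nonneg eL by (simp add: sum_ennreal)
    also have "\<dots> = (\<Sum>j\<in>e -` A. ennreal (c (e j)) * indicator {A. e j \<in> A} A)"
      by (rule sum.cong) auto
    also have "\<dots> = (\<Sum>j. ennreal (c (e j)) * indicator {A. e j \<in> A} A)"
      by (rule suminf_finite[symmetric, OF fin]) auto
    finally show ?thesis .
  qed
  then have "(\<integral>\<^sup>+A. W A * ennreal (\<Sum>l\<in>A. c l) \<partial>count_space (finite_subsets L)) =
      (\<integral>\<^sup>+A. (\<Sum>j. ennreal (c (e j)) * (W A * indicator {A. e j \<in> A} A)) \<partial>count_space (finite_subsets L))"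
    by (intro nn_integral_cong) (simp add: mult.left_commute flip: ennreal_suminf_cmult)
  also have "\<dots> = (\<Sum>j. ennreal (c (e j)) *
      (\<integral>\<^sup>+A. W A * indicator {A. e j \<in> A} A \<partial>count_space (finite_subsets L)))"
    by (simp add: nn_integral_suminf nn_integral_cmult)
  also have "\<dots> = (\<Sum>j. ennreal (c (e j) * (w (e j) / (1 + w (e j)))) *
      (\<integral>\<^sup>+A. W A \<partial>count_space (finite_subsets L)))"
  proof (rule suminf_cong)
    fix j
    show "ennreal (c (e j)) * (\<integral>\<^sup>+A. W A * indicator {A. e j \<in> A} A \<partial>count_space (finite_subsets L)) =
      ennreal (c (e j) * (w (e j) / (1 + w (e j)))) * (\<integral>\<^sup>+A. W A \<partial>count_space (finite_subsets L))"
      unfolding W_def ennreal_mult'[OF nonneg(2)[OF eL]] mult.assoc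
      by (subst nn_integral_prod_finite_subsets_member[OF nonneg(1) eL]) simp_all
  qed
  finally show ?thesis
    by (simp add: W_def)
qed

section \<open>Strict partitions as finite sets of powers\<close>

lemma bij_betw_Suc_power_qth_powers:
  assumes "1 \<le> q"
  shows "bij_betw (\<lambda>j. Suc j ^ q) UNIV (qth_powers q)"
proof -
  have "inj (\<lambda>j. Suc j ^ q)"
    using assms by (intro injI) (simp add: power_eq_iff_eq_base del: power_Suc)
  moreover have "range (\<lambda>j. Suc j ^ q) = qth_powers q"
    by (auto simp: qth_powers_def image_iff dest!: Suc_le_D)
  ultimately show ?thesis by (simp add: bij_betw_def)
qed

lemma bij_betw_set_strict_partitions:
  "bij_betw set (strict_partitions q) (finite_subsets (qth_powers q))"
proof (rule bij_betwI[where g = "\<lambda>A. rev (sorted_list_of_set A)"])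
  show "rev (sorted_list_of_set (set ps)) = ps" if "ps \<in> strict_partitions q" for ps
  proof -
    have "sorted_wrt (<) (rev ps)"
      using that by (simp add: strict_partitions_def sorted_wrt_rev)
    then have "sorted_list_of_set (set (rev ps)) = rev ps"
      by (simp add: strict_sorted_iff sorted_list_of_set.idem_if_sorted_distinct del: set_rev)
    then show ?thesis by simp
  qed
qed (auto simp: strict_partitions_def finite_subsets_def sorted_wrt_rev)

lemma strict_partitions_distinct: "ps \<in> strict_partitions q \<Longrightarrow> distinct ps"
  using strict_sorted_iff[of "rev ps"] by (simp add: strict_partitions_def sorted_wrt_rev)

lemma strict_partitions_statistics:
  assumes "ps \<in> strict_partitions q"
  shows "weight ps = \<Sum>(set ps)" "num_parts ps = card (set ps)"
    "boltzmann_weight (z1, z2) ps = (\<Prod>l\<in>set ps. z2 * z1 ^ l)"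
proof -
  note d = strict_partitions_distinct[OF assms]
  show 1: "weight ps = \<Sum>(set ps)" "num_parts ps = card (set ps)"
    using d by (simp_all add: weight_eq_sum_list num_parts_eq_length distinct_card
        sum_list_distinct_conv_sum_set[of ps "\<lambda>x. x", simplified])
  show "boltzmann_weight (z1, z2) ps = (\<Prod>l\<in>set ps. z2 * z1 ^ l)"
    by (simp add: boltzmann_weight_def 1 prod.distrib power_sum mult.commute)
qed

text \<open>The partition function cancels against the total weight of the finite sets of parts.
  Summability with the plain odds in place of the probabilities suffices, as odds dominate
  probabilities; it brings the identity from \<open>ennreal\<close> back to the reals.\<close>

lemma boltzmann_expectation_additive:
  fixes c :: "nat \<Rightarrow> real"
  assumes q: "1 \<le> q" and z1: "0 < z1" "z1 < 1" and z2: "0 < z2"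
    and c: "\<And>l. 0 \<le> c l"
    and summ: "summable (\<lambda>j. c (Suc j ^ q) * (z2 * z1 ^ (Suc j ^ q)))"
  shows "(\<integral>ps. (\<Sum>l\<in>set ps. c l) \<partial>boltzmann q (z1, z2)) =
    (\<Sum>j. c (Suc j ^ q) * (z2 * z1 ^ (Suc j ^ q) / (1 + z2 * z1 ^ (Suc j ^ q))))"
proof -
  define w where "w = (\<lambda>l::nat. z2 * z1 ^ l)"
  define L where "L = qth_powers q"
  define I where "I = (\<integral>\<^sup>+A. ennreal (\<Prod>l\<in>A. w l) \<partial>count_space (finite_subsets L))"
  define Z where "Z = partition_function q (z1, z2)"
  have w0: "0 < w l" for l using z1 z2 by (simp add: w_def)
  have e: "bij_betw (\<lambda>j. Suc j ^ q) UNIV L"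
    unfolding L_def by (rule bij_betw_Suc_power_qth_powers[OF q])
  note set_bij = bij_betw_set_strict_partitions[of q, folded L_def]
  have "w summable_on UNIV"
    using z1 z2 unfolding w_def
    by (intro summable_on_cmult_right summable_nonneg_imp_summable_on) (auto simp: summable_geometric)
  then have "w summable_on L" by (rule summable_on_subset_banach) auto
  then have sum: "(\<lambda>A. \<Prod>l\<in>A. w l) summable_on finite_subsets L"
    using w0 by (intro summable_on_prod_finite_subsets) (auto intro: less_imp_le)
  have W0: "0 \<le> (\<Prod>l\<in>A. w l)" for A using w0 by (intro prod_nonneg) (simp add: less_imp_le)
  have "Z = infsum (\<lambda>ps. \<Prod>l\<in>set ps. w l) (strict_partitions q)"
    unfolding Z_def partition_function_def w_def
    by (rule infsum_cong) (rule strict_partitions_statistics)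
  also have "\<dots> = infsum (\<lambda>A. \<Prod>l\<in>A. w l) (finite_subsets L)"
    using infsum_reindex_bij_betw[OF set_bij, of "\<lambda>A. \<Prod>l\<in>A. w l"] by simp
  finally have Z: "Z = infsum (\<lambda>A. \<Prod>l\<in>A. w l) (finite_subsets L)" .
  have abs: "Infinite_Set_Sum.abs_summable_on (\<lambda>A. \<Prod>l\<in>A. w l) (finite_subsets L)"
    using sum W0 by (simp add: abs_summable_equivalent[symmetric])
  have IZ: "I = ennreal Z"
    unfolding I_def Z using nn_integral_conv_infsetsum[OF abs W0] infsetsum_infsum[OF abs] by simp
  \<comment> \<open>The empty partition alone contributes 1, so division by \<open>Z\<close> is
    harmless.\<close>
  have "(\<Prod>l\<in>{}. w l) \<le> Z"
    unfolding Z using finite_sum_le_infsum[OF sum, of "{{}}"] W0 by (simp add: finite_subsets_def)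
  then have Z1: "1 \<le> Z" by simp
  have pos: "0 \<le> c (Suc j ^ q) * (w (Suc j ^ q) / (1 + w (Suc j ^ q)))" for j
    using c w0 by (simp add: less_imp_le add_nonneg_nonneg)
  have summ': "summable (\<lambda>j. c (Suc j ^ q) * (w (Suc j ^ q) / (1 + w (Suc j ^ q))))"
  proof (rule summable_comparison_test'[OF summ, of 0])
    fix j :: nat
    have "c (Suc j ^ q) * (w (Suc j ^ q) / (1 + w (Suc j ^ q))) \<le> c (Suc j ^ q) * w (Suc j ^ q)"
      using w0[of "Suc j ^ q"] c by (intro mult_left_mono) (simp_all add: divide_le_eq)
    with pos[of j] show "norm (c (Suc j ^ q) * (w (Suc j ^ q) / (1 + w (Suc j ^ q)))) \<le>
        c (Suc j ^ q) * (z2 * z1 ^ Suc j ^ q)"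
      unfolding w_def by (simp only: real_norm_def abs_of_nonneg)
  qed
  have meas: "f \<in> borel_measurable (boltzmann q (z1, z2))" for f :: "nat list \<Rightarrow> real"
    by (simp add: boltzmann_def point_measure_def)
  have "(\<integral>\<^sup>+ps. ennreal (\<Sum>l\<in>set ps. c l) \<partial>boltzmann q (z1, z2)) =
      (\<integral>\<^sup>+ps. ennreal (boltzmann_weight (z1, z2) ps / Z) * ennreal (\<Sum>l\<in>set ps. c l)
         \<partial>count_space (strict_partitions q))"
    unfolding boltzmann_def point_measure_def Z_def by (rule nn_integral_density) auto
  also have "\<dots> = (\<integral>\<^sup>+ps. ennreal (1 / Z) * (ennreal (\<Prod>l\<in>set ps. w l) * ennreal (\<Sum>l\<in>set ps. c l))
         \<partial>count_space (strict_partitions q))"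
    using Z1 W0 strict_partitions_statistics(3)[of _ q z1 z2]
    by (intro nn_integral_cong) (simp add: w_def flip: ennreal_mult' mult.assoc)
  also have "\<dots> = ennreal (1 / Z) * (\<integral>\<^sup>+ps. ennreal (\<Prod>l\<in>set ps. w l) * ennreal (\<Sum>l\<in>set ps. c l)
         \<partial>count_space (strict_partitions q))"
    by (rule nn_integral_cmult) simp
  also have "(\<integral>\<^sup>+ps. ennreal (\<Prod>l\<in>set ps. w l) * ennreal (\<Sum>l\<in>set ps. c l)
         \<partial>count_space (strict_partitions q)) =
      (\<integral>\<^sup>+A. ennreal (\<Prod>l\<in>A. w l) * ennreal (\<Sum>l\<in>A. c l) \<partial>count_space (finite_subsets L))"
    by (rule nn_integral_bij_count_space[OF set_bij])
  also have "\<dots> = (\<Sum>j. ennreal (c (Suc j ^ q) * (w (Suc j ^ q) / (1 + w (Suc j ^ q))))) * I"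
    unfolding I_def using w0 c
    by (intro nn_integral_prod_finite_subsets_additive[OF _ _ e]) (auto intro: less_imp_le)
  also have "(\<Sum>j. ennreal (c (Suc j ^ q) * (w (Suc j ^ q) / (1 + w (Suc j ^ q))))) =
      ennreal (\<Sum>j. c (Suc j ^ q) * (w (Suc j ^ q) / (1 + w (Suc j ^ q))))"
    by (rule suminf_ennreal2[OF pos summ'])
  finally have nn: "(\<integral>\<^sup>+ps. ennreal (\<Sum>l\<in>set ps. c l) \<partial>boltzmann q (z1, z2)) =
      ennreal (\<Sum>j. c (Suc j ^ q) * (w (Suc j ^ q) / (1 + w (Suc j ^ q))))"
    using Z1 by (simp add: IZ mult.left_commute[of "ennreal (1 / Z)"] flip: ennreal_mult')
  have "0 \<le> (\<Sum>j. c (Suc j ^ q) * (w (Suc j ^ q) / (1 + w (Suc j ^ q))))"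
    by (rule suminf_nonneg[OF summ' pos])
  then show ?thesis
    using c by (subst integral_eq_nn_integral[OF meas]) (auto simp: nn w_def intro: sum_nonneg)
qed

section \<open>Mean weight and length as functions of the parameters\<close>

definition prob_of_odds :: "real \<Rightarrow> real" where
  "prob_of_odds y = y / (1 + y)"

lemma prob_of_odds_strict_mono: "0 \<le> x \<Longrightarrow> x < y \<Longrightarrow> prob_of_odds x < prob_of_odds y"
  by (simp add: prob_of_odds_def field_simps)

lemma prob_of_odds_bounds:
  assumes "0 \<le> x" "x \<le> z"
  shows "x / (1 + z) \<le> prob_of_odds x" "prob_of_odds x \<le> x" "0 \<le> prob_of_odds x"
proof -
  show "x / (1 + z) \<le> prob_of_odds x"
    unfolding prob_of_odds_def using assms by (intro divide_left_mono) auto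
  show "prob_of_odds x \<le> x"
    unfolding prob_of_odds_def using assms by (simp add: divide_le_eq distrib_left)
qed (use assms in \<open>simp add: prob_of_odds_def\<close>)

text \<open>With \<open>z1 = exp (- a)\<close> and \<open>z2 = z\<close> this will be the mean
  length for \<open>k = 0\<close> and the mean weight for \<open>k = 1\<close>.\<close>

definition occupation_sum :: "nat \<Rightarrow> nat \<Rightarrow> real \<Rightarrow> real \<Rightarrow> real" where
  "occupation_sum q k a z =
     (\<Sum>j. (real (Suc j) ^ q) ^ k * prob_of_odds (z * exp (- (a * real (Suc j) ^ q))))"

text \<open>The odds of every part are at most \<open>z\<close>, so the denominator of its
  probability lies between \<open>1\<close> and \<open>1 + z\<close>, uniformly in
  \<open>l\<close>.\<close>

lemma occupation_bounds:
  fixes l :: real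
  assumes "0 < a" "0 \<le> z" "0 \<le> l"
  shows "z / (1 + z) * (l ^ k * exp (- (a * l))) \<le> l ^ k * prob_of_odds (z * exp (- (a * l)))"
    "l ^ k * prob_of_odds (z * exp (- (a * l))) \<le> z * (l ^ k * exp (- (a * l)))"
    "0 \<le> l ^ k * prob_of_odds (z * exp (- (a * l)))"
proof -
  have x: "0 \<le> z * exp (- (a * l))" "z * exp (- (a * l)) \<le> z"
    using assms by (auto intro!: mult_left_le)
  show "z / (1 + z) * (l ^ k * exp (- (a * l))) \<le> l ^ k * prob_of_odds (z * exp (- (a * l)))"
    using mult_left_mono[OF prob_of_odds_bounds(1)[OF x], of "l ^ k"] assms by (simp add: mult_ac)
  show "l ^ k * prob_of_odds (z * exp (- (a * l))) \<le> z * (l ^ k * exp (- (a * l)))"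
    using mult_left_mono[OF prob_of_odds_bounds(2)[OF x], of "l ^ k"] assms by (simp add: mult_ac)
  show "0 \<le> l ^ k * prob_of_odds (z * exp (- (a * l)))"
    using prob_of_odds_bounds(3)[OF x] assms by simp
qed

lemma summable_occupation:
  assumes "1 \<le> q" "k \<le> 1" "0 < a" "0 \<le> z"
  shows "summable (\<lambda>j. (real (Suc j) ^ q) ^ k * prob_of_odds (z * exp (- (a * real (Suc j) ^ q))))"
proof (rule summable_comparison_test'[where N = 0])
  show "summable (\<lambda>j. z * ((real (Suc j) ^ q) ^ k * exp (- (a * real (Suc j) ^ q))))"
    using summable_power_exp[OF assms(1-3)] by (rule summable_mult)
  show "norm ((real (Suc j) ^ q) ^ k * prob_of_odds (z * exp (- (a * real (Suc j) ^ q))))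
      \<le> z * ((real (Suc j) ^ q) ^ k * exp (- (a * real (Suc j) ^ q)))" for j
    using occupation_bounds(2,3)[OF assms(3,4), of "real (Suc j) ^ q" k]
    by (simp only: real_norm_def abs_of_nonneg zero_le_power of_nat_0_le_iff)
qed

lemma occupation_sum_bounds:
  assumes "1 \<le> q" "k \<le> 1" "0 < a" "0 \<le> z"
  shows "z / (1 + z) * power_exp_sum q k a \<le> occupation_sum q k a z"
    "occupation_sum q k a z \<le> z * power_exp_sum q k a"
proof -
  note S = summable_power_exp[OF assms(1-3)] summable_occupation[OF assms]
  show "z / (1 + z) * power_exp_sum q k a \<le> occupation_sum q k a z"
    unfolding power_exp_sum_def occupation_sum_def suminf_mult[OF S(1), symmetric]
    using assms by (intro suminf_le occupation_bounds summable_mult S) auto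
  show "occupation_sum q k a z \<le> z * power_exp_sum q k a"
    unfolding power_exp_sum_def occupation_sum_def suminf_mult[OF S(1), symmetric]
    using assms by (intro suminf_le occupation_bounds summable_mult S) auto
qed

text \<open>This removes measure theory from the problem: with \<open>a = - ln z1\<close> only two
  equations between real series remain.\<close>

lemma calibration_root_iff_occupation_sum:
  assumes q: "1 \<le> q"
  shows "calibration_root q n m (z1, z2) \<longleftrightarrow> 0 < z1 \<and> z1 < 1 \<and> 0 < z2 \<and>
    occupation_sum q 1 (- ln z1) z2 = n \<and> occupation_sum q 0 (- ln z1) z2 = m"
proof (cases "0 < z1 \<and> z1 < 1 \<and> 0 < z2")
  case True
  then have z: "0 < z1" "z1 < 1" "0 < z2" by auto
  have pow: "z1 ^ (Suc j ^ q) = exp (- (- ln z1 * real (Suc j) ^ q))" for j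
  proof -
    have "exp (real (Suc j ^ q) * ln z1) = z1 ^ (Suc j ^ q)"
      using z by (simp only: exp_of_nat_mult exp_ln)
    then show ?thesis by (simp add: mult.commute)
  qed
  have summ: "summable (\<lambda>j. real (Suc j ^ q) ^ k * (z2 * z1 ^ (Suc j ^ q)))" if "k \<le> 1" for k
    unfolding pow of_nat_power mult.left_commute[of _ z2]
    using z by (intro summable_mult summable_power_exp[OF q that]) simp
  have mean: "(\<integral>ps. (\<Sum>l\<in>set ps. real l ^ k) \<partial>boltzmann q (z1, z2)) = occupation_sum q k (- ln z1) z2"
    if "k \<le> 1" for k
    using boltzmann_expectation_additive[OF q z, of "\<lambda>l. real l ^ k", OF _ summ[OF that]]
    unfolding occupation_sum_def prob_of_odds_def pow of_nat_power by simp
  have "space (boltzmann q (z1, z2)) = strict_partitions q"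
    by (simp add: boltzmann_def space_point_measure)
  then have "(\<integral>ps. real (weight ps) \<partial>boltzmann q (z1, z2)) =
      (\<integral>ps. (\<Sum>l\<in>set ps. real l ^ 1) \<partial>boltzmann q (z1, z2))"
    "(\<integral>ps. real (num_parts ps) \<partial>boltzmann q (z1, z2)) =
      (\<integral>ps. (\<Sum>l\<in>set ps. real l ^ 0) \<partial>boltzmann q (z1, z2))"
    by (auto simp: strict_partitions_statistics intro!: Bochner_Integration.integral_cong)
  then show ?thesis
    using z mean[of 0] mean[of 1] by (auto simp: calibration_root_def)
qed (auto simp: calibration_root_def)

text \<open>
  With \<open>d l\<close> the difference of the two occupation probabilities of the part \<open>l\<close> and \<open>t l\<close> the
  difference of their log-odds, \<open>t l\<close> is affine in \<open>l\<close>, so the two equations give \<open>\<Sum>l. t l * d l = 0\<close>;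
  but \<open>t l\<close> and \<open>d l\<close> have the same sign.
\<close>

lemma occupation_sum_inj:
  assumes q: "1 \<le> q" and pos: "0 < a" "0 < b" "0 < z" "0 < y"
    and eq: "occupation_sum q 0 a z = occupation_sum q 0 b y"
      "occupation_sum q 1 a z = occupation_sum q 1 b y"
  shows "a = b \<and> z = y"
proof -
  define l where "l = (\<lambda>j. real (Suc j) ^ q)"
  define p where "p = (\<lambda>a z j. prob_of_odds (z * exp (- (a * l j))))"
  define t where "t = (\<lambda>j. (b - a) * l j + (ln z - ln y))"
  define d where "d = (\<lambda>j. p a z j - p b y j)"
  have S: "summable (\<lambda>j. l j ^ k * p a z j)" "summable (\<lambda>j. l j ^ k * p b y j)" if "k \<le> 1" for k
    unfolding l_def p_def using summable_occupation[OF q that] pos by auto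
  have Sd: "(\<lambda>j. l j ^ k * d j) sums 0" if "k \<le> 1" for k
  proof -
    have "k = 0 \<or> k = 1" using that by linarith
    then have "occupation_sum q k a z = occupation_sum q k b y" using eq by auto
    then have "(\<lambda>j. l j ^ k * p a z j - l j ^ k * p b y j) sums 0"
      using sums_diff[OF S[OF that, THEN summable_sums]]
      by (simp add: occupation_sum_def l_def p_def)
    then show ?thesis by (simp add: d_def right_diff_distrib)
  qed
  have sums: "(\<lambda>j. t j * d j) sums 0"
    using sums_add[OF sums_mult[OF Sd[of 1], of "b - a"] sums_mult[OF Sd[of 0], of "ln z - ln y"]]
    by (simp add: t_def algebra_simps)
  have odds: "z * exp (- (a * l j)) = exp (t j) * (y * exp (- (b * l j)))" for j
    using pos by (simp add: t_def exp_add exp_diff left_diff_distrib exp_minus field_simps)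
  have sgn: "0 \<le> t j * d j \<and> (t j * d j = 0 \<longrightarrow> t j = 0)" for j
  proof -
    have y: "0 < y * exp (- (b * l j))" using pos by simp
    consider "t j = 0" | "t j < 0" | "0 < t j" by linarith
    then show ?thesis
    proof cases
      case 2
      then have "z * exp (- (a * l j)) < y * exp (- (b * l j))"
        unfolding odds using mult_strict_right_mono[OF _ y, of "exp (t j)" 1] by simp
      then have "d j < 0"
        unfolding d_def p_def using pos prob_of_odds_strict_mono[of "z * exp (- (a * l j))"] by simp
      with 2 show ?thesis by (simp add: mult_neg_neg less_imp_le)
    next
      case 3
      then have "y * exp (- (b * l j)) < z * exp (- (a * l j))"
        unfolding odds using mult_strict_right_mono[OF _ y, of 1 "exp (t j)"] by simp
      then have "0 < d j"
        unfolding d_def p_def using pos prob_of_odds_strict_mono[of "y * exp (- (b * l j))"] by simp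
      with 3 show ?thesis by (simp add: less_imp_le)
    qed simp
  qed
  then have "t j = 0" for j
    using suminf_eq_zero_iff[OF sums_summable[OF sums]] sums_unique[OF sums] by metis
  \<comment> \<open>An affine function vanishing at the two distinct parts \<open>1\<close> and
    \<open>2 ^ q\<close> is zero.\<close>
  then have "(b - a) * l 0 + (ln z - ln y) = 0" "(b - a) * l 1 + (ln z - ln y) = 0"
    by (simp_all add: t_def)
  then have "(b - a) * (l 1 - l 0) = 0" by (simp add: algebra_simps)
  moreover have "l 0 = 1" by (simp add: l_def)
  moreover have "1 < l 1" unfolding l_def by (rule one_less_power) (use q in auto)
  ultimately have "a = b" by simp
  with \<open>(b - a) * l 0 + (ln z - ln y) = 0\<close> pos show ?thesis by simp
qed

text \<open>Ensures that for fixed \<open>a\<close> the second equation has at most one solution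
  \<open>z\<close>.\<close>

lemma occupation_sum_strict_mono:
  assumes "1 \<le> q" "k \<le> 1" "0 < a" "0 \<le> z" "z < y"
  shows "occupation_sum q k a z < occupation_sum q k a y"
proof -
  let ?f = "\<lambda>z j. (real (Suc j) ^ q) ^ k * prob_of_odds (z * exp (- (a * real (Suc j) ^ q)))"
  have S: "summable (?f z)" "summable (?f y)"
    using assms by (auto intro!: summable_occupation simp del: of_nat_Suc)
  have "?f z j < ?f y j" for j
    using assms by (intro mult_strict_left_mono prob_of_odds_strict_mono) auto
  then have "0 < (\<Sum>j. ?f y j - ?f z j)"
    by (intro suminf_pos summable_diff S) (simp del: of_nat_Suc)
  then show ?thesis
    by (simp add: occupation_sum_def suminf_diff[OF S(2) S(1), symmetric] del: of_nat_Suc)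
qed

text \<open>Weierstrass test: on the strip the term at \<open>a = b\<close>, \<open>z = Z\<close>
  without its denominator is a summable majorant. Joint continuity is needed since \<open>z\<close>
  will vary with \<open>a\<close>.\<close>

lemma continuous_on_occupation_sum:
  assumes "1 \<le> q" "k \<le> 1" "0 < b" "0 \<le> Z"
  shows "continuous_on ({b..c} \<times> {0..Z}) (\<lambda>(a, z). occupation_sum q k a z)"
proof -
  let ?f = "\<lambda>j (a, z). (real (Suc j) ^ q) ^ k * prob_of_odds (z * exp (- (a * real (Suc j) ^ q)))"
  let ?S = "{b..c} \<times> {0..Z}"
  have "uniform_limit ?S (\<lambda>n x. \<Sum>j<n. ?f j x) (\<lambda>x. \<Sum>j. ?f j x) sequentially"
  proof (rule Weierstrass_m_test)
    show "summable (\<lambda>j. Z * ((real (Suc j) ^ q) ^ k * exp (- (b * real (Suc j) ^ q))))"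
      using assms by (intro summable_mult summable_power_exp) auto
    fix j x assume "x \<in> ?S"
    then obtain a z where x: "x = (a, z)" "b \<le> a" "0 \<le> z" "z \<le> Z" by auto
    define l where "l = real (Suc j) ^ q"
    have l: "0 \<le> l" by (simp add: l_def)
    have "l ^ k * prob_of_odds (z * exp (- (a * l))) \<le> z * (l ^ k * exp (- (a * l)))"
      "0 \<le> l ^ k * prob_of_odds (z * exp (- (a * l)))"
      using x assms l by (auto intro!: occupation_bounds)
    moreover have "z * (l ^ k * exp (- (a * l))) \<le> Z * (l ^ k * exp (- (b * l)))"
      using x assms l by (intro mult_mono) (auto intro!: mult_right_mono)
    ultimately show "norm (?f j x) \<le> Z * ((real (Suc j) ^ q) ^ k * exp (- (b * real (Suc j) ^ q)))"
      unfolding x l_def[symmetric] by (simp only: prod.case real_norm_def abs_of_nonneg)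
  qed
  moreover have "continuous_on ?S (\<lambda>x. \<Sum>j<n. ?f j x)" for n
  proof -
    have "1 + snd x * exp (- (fst x * real (Suc j) ^ q)) \<noteq> 0" if "x \<in> ?S" for x j
      using that by (intro less_imp_neq[symmetric] add_pos_nonneg) auto
    then show ?thesis
      unfolding prob_of_odds_def split_beta by (intro continuous_intros) auto
  qed
  ultimately have "continuous_on ?S (\<lambda>x. \<Sum>j. ?f j x)"
    by (intro uniform_limit_theorem[OF always_eventually]) auto
  then show ?thesis by (simp add: occupation_sum_def split_beta)
qed

section \<open>Existence and asymptotics of the root\<close>

text \<open>The functional equation of \<open>Gamma\<close> expresses the main terms for both values
  of \<open>k\<close> through the single constant \<open>G\<close>, and the error becomes
  relative.\<close>

lemma power_exp_sum_normalized:
  fixes a :: real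
  assumes q: "1 \<le> q" and k: "k \<le> 1" and a: "0 < a"
  defines "u \<equiv> root q a" and "G \<equiv> Gamma (1 + 1 / real q)"
  shows "\<bar>power_exp_sum q k a * (real q * a) ^ k * u / G - 1\<bar> \<le> 2 * real q / G * u"
proof -
  have G: "0 < G" unfolding G_def by (intro Gamma_real_pos) (simp add: add_pos_nonneg)
  have u: "0 < u" using q a by (simp add: u_def)
  have pu: "a powr (real k + 1 / real q) = a ^ k * u"
    using a q by (simp add: powr_add powr_realpow u_def root_powr_inverse)
  have Gk: "Gamma (real k + 1 / real q) = G * real q / real q ^ k"
  proof -
    consider "k = 0" | "k = 1" using k by linarith
    then show ?thesis
    proof cases
      case 1
      have "Gamma (1 / real q + 1) = 1 / real q * Gamma (1 / real q)"
        using q by (intro Gamma_plus1) (auto dest: nonpos_Ints_nonpos)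
      with 1 q show ?thesis by (simp add: G_def add.commute)
    qed (use q in \<open>simp add: G_def\<close>)
  qed
  \<comment> \<open>The reciprocal of the main term.\<close>
  define c where "c = (real q * a) ^ k * u / G"
  have c: "0 < c" using q a u G by (simp add: c_def)
  have "\<bar>power_exp_sum q k a - Gamma (real k + 1 / real q) / (real q * (a ^ k * u))\<bar> \<le> 2 / a ^ k"
    using power_exp_sum_bound[OF q k a] by (simp add: pu)
  then have "\<bar>power_exp_sum q k a - Gamma (real k + 1 / real q) / (real q * (a ^ k * u))\<bar> * c \<le> 2 / a ^ k * c"
    using c by (intro mult_right_mono) auto
  also have "\<bar>power_exp_sum q k a - Gamma (real k + 1 / real q) / (real q * (a ^ k * u))\<bar> * c
      = \<bar>power_exp_sum q k a * c - Gamma (real k + 1 / real q) / (real q * (a ^ k * u)) * c\<bar>"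
    using c by (simp only: abs_mult abs_of_pos flip: left_diff_distrib)
  also have "Gamma (real k + 1 / real q) / (real q * (a ^ k * u)) * c = 1"
    using q a u G unfolding Gk c_def by (simp add: power_mult_distrib)
  also have "2 / a ^ k * c = 2 * real q ^ k / G * u"
    using a by (simp add: c_def power_mult_distrib)
  also have "\<dots> \<le> 2 * real q / G * u"
    using u G q power_increasing[OF k, of "real q"]
    by (intro mult_right_mono divide_right_mono mult_left_mono) auto
  finally show ?thesis by (simp add: c_def)
qed

text \<open>Replacing probabilities by odds costs a factor between \<open>1 / (1 + z)\<close> and
  \<open>1\<close>, hence a further relative error of order \<open>z\<close>.\<close>

lemma occupation_sum_normalized:
  assumes q: "1 \<le> q" and k: "k \<le> 1" and a: "0 < a" and z: "0 < z" "z \<le> 1"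
  defines "u \<equiv> root q a" and "G \<equiv> Gamma (1 + 1 / real q)"
  shows "\<bar>occupation_sum q k a z * (real q * a) ^ k * u / (G * z) - 1\<bar> \<le> (1 + 2 * real q / G) * (u + z)"
proof -
  have G: "0 < G" unfolding G_def by (intro Gamma_real_pos) (simp add: add_pos_nonneg)
  have u: "0 < u" using q a by (simp add: u_def)
  define c where "c = (real q * a) ^ k * u / G"
  define x where "x = power_exp_sum q k a * c"
  define y where "y = occupation_sum q k a z * c / z"
  define d where "d = 2 * real q / G"
  have c: "0 < c" using q a u G by (simp add: c_def)
  have d: "0 < d" using q G by (simp add: d_def)
  have x1: "\<bar>x - 1\<bar> \<le> d * u"
    using power_exp_sum_normalized[OF q k a] by (simp add: x_def c_def d_def u_def G_def)
  have "0 \<le> power_exp_sum q k a"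
    unfolding power_exp_sum_def by (intro suminf_nonneg summable_power_exp q k a) simp
  then have x0: "0 \<le> x" using c by (simp add: x_def)
  note b = occupation_sum_bounds[OF q k a less_imp_le[OF z(1)]]
  have "y \<le> x"
    using mult_right_mono[OF b(2), of "c / z"] c z by (simp add: x_def y_def)
  moreover have "x / (1 + z) \<le> y"
    using mult_right_mono[OF b(1), of "c / z"] c z by (simp add: x_def y_def)
  moreover have "x * (1 - z) \<le> x / (1 + z)"
  proof -
    have "(1 - z) * (1 + z) \<le> 1" by (simp add: algebra_simps)
    then have "1 - z \<le> 1 / (1 + z)" using z by (simp add: le_divide_eq)
    from mult_left_mono[OF this x0] show ?thesis by simp
  qed
  moreover have "(1 - d * u) * (1 - z) \<le> x * (1 - z)"
    using x1 z by (intro mult_right_mono) auto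
  moreover have "1 - d * u - z \<le> (1 - d * u) * (1 - z)"
    using d u z by (simp add: algebra_simps)
  moreover have "d * u + z \<le> (1 + d) * (u + z)" "d * u \<le> (1 + d) * (u + z)"
    using d u z by (simp_all add: algebra_simps)
  ultimately have "\<bar>y - 1\<bar> \<le> (1 + d) * (u + z)"
    using x1 by linarith
  then show ?thesis by (simp add: y_def c_def d_def)
qed

lemma abs_quotient_minus_one_le:
  fixes x y d e :: real
  assumes "\<bar>x - 1\<bar> \<le> d" "\<bar>y - 1\<bar> \<le> e" "e \<le> 1 / 2"
  shows "\<bar>x / y - 1\<bar> \<le> 2 * (d + e)"
proof -
  have y: "1 / 2 \<le> y" using assms by linarith
  have "x / y - 1 = (x - y) / y"
    using y by (simp add: diff_divide_distrib)
  then have "\<bar>x / y - 1\<bar> = \<bar>x - y\<bar> / y"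
    using y by simp
  also have "\<dots> \<le> (d + e) / (1 / 2)"
    using assms y by (intro frac_le) auto
  finally show ?thesis by simp
qed

text \<open>The first estimate links \<open>z\<close> to \<open>a\<close> through the second
  equation. In the second estimate the quotient of the two sums cancels \<open>z\<close> and the
  Gamma factor, so it locates \<open>a\<close> alone.\<close>

lemma calibration_estimates:
  assumes q: "1 \<le> q"
  obtains K where "0 < K" and
    "\<And>a z. 0 < a \<Longrightarrow> 0 < z \<Longrightarrow> K * (root q a + z) \<le> 1 \<Longrightarrow>
      \<bar>occupation_sum q 0 a z * root q a / (Gamma (1 + 1 / real q) * z) - 1\<bar> \<le> K * (root q a + z) \<and>
      \<bar>real q * a * occupation_sum q 1 a z / occupation_sum q 0 a z - 1\<bar> \<le> K * (root q a + z)"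
proof
  define G where "G = Gamma (1 + 1 / real q)"
  have G: "0 < G" unfolding G_def by (intro Gamma_real_pos) (simp add: add_pos_nonneg)
  define c where "c = 1 + 2 * real q / G"
  have c: "1 \<le> c" using G q by (simp add: c_def)
  \<comment> \<open>The factor 4 absorbs the loss in the quotient of two quantities with error
    \<open>c * (root q a + z)\<close>; the smallness condition then also forces
    \<open>z \<le> 1\<close> and keeps the denominator near 1.\<close>
  then show "0 < 4 * c" by simp
  fix a z :: real assume a: "0 < a" and z: "0 < z" and le: "4 * c * (root q a + z) \<le> 1"
  have u: "0 < root q a" using a q by simp
  have "root q a + z \<le> c * (root q a + z)"
    using c u z by simp
  then have z1: "z \<le> 1" using le u by linarith
  define x where "x = (\<lambda>k. occupation_sum q k a z * (real q * a) ^ k * root q a / (G * z))"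
  have x: "\<bar>x k - 1\<bar> \<le> c * (root q a + z)" if "k \<le> 1" for k
    using occupation_sum_normalized[OF q that a z z1] by (simp add: x_def c_def G_def)
  have "0 < c * (root q a + z)" using c u z by (intro mult_pos_pos) auto
  with x[of 0] have 0: "\<bar>x 0 - 1\<bar> \<le> 4 * c * (root q a + z)" by linarith
  have "\<bar>x 1 / x 0 - 1\<bar> \<le> 2 * (c * (root q a + z) + c * (root q a + z))"
    using le x by (intro abs_quotient_minus_one_le) auto
  moreover have "x 1 / x 0 = real q * a * occupation_sum q 1 a z / occupation_sum q 0 a z"
    using u z G by (simp add: x_def)
  ultimately show "\<bar>occupation_sum q 0 a z * root q a / (Gamma (1 + 1 / real q) * z) - 1\<bar> \<le> 4 * c * (root q a + z) \<and>
      \<bar>real q * a * occupation_sum q 1 a z / occupation_sum q 0 a z - 1\<bar> \<le> 4 * c * (root q a + z)"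
    using 0 by (simp add: x_def G_def)
qed

text \<open>Powers push nonnegative numbers away from 1. This carries the estimate for
  \<open>real q * a * n / m\<close> over to its \<open>q\<close>-th root.\<close>

lemma abs_minus_one_le_power:
  fixes r :: real
  assumes "0 \<le> r" "1 \<le> n"
  shows "\<bar>r - 1\<bar> \<le> \<bar>r ^ n - 1\<bar>"
proof (cases "1 \<le> r")
  case True
  then show ?thesis using self_le_power[of r n] assms by simp
next
  case False
  then show ?thesis using power_decreasing[of 1 n r] assms by simp
qed

text \<open>For each \<open>a\<close> the intermediate value theorem between \<open>0\<close> and
  \<open>Z\<close> gives a solution, and strict monotonicity makes it unique. Continuity needs no
  derivatives: the graph is closed and the values stay in a compact interval.\<close>

lemma calibration_implicit_solution:
  assumes q: "1 \<le> q" and b: "0 < b" and m: "0 < m" and Z: "0 < Z"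
    and upper: "\<And>a. b \<le> a \<Longrightarrow> a \<le> c \<Longrightarrow> m \<le> occupation_sum q 0 a Z"
  obtains \<zeta> where "continuous_on {b..c} \<zeta>"
    "\<And>a. b \<le> a \<Longrightarrow> a \<le> c \<Longrightarrow> 0 < \<zeta> a \<and> \<zeta> a \<le> Z \<and> occupation_sum q 0 a (\<zeta> a) = m"
proof -
  let ?S = "{b..c} \<times> {0..Z}"
  have cont: "continuous_on ?S (\<lambda>(a, z). occupation_sum q 0 a z)"
    using q b Z by (intro continuous_on_occupation_sum) auto
  have zero: "occupation_sum q 0 a 0 = 0" for a
    by (simp add: occupation_sum_def prob_of_odds_def)
  have "\<exists>z. 0 \<le> z \<and> z \<le> Z \<and> occupation_sum q 0 a z = m" if a: "a \<in> {b..c}" for a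
  proof (rule IVT')
    have "continuous_on {0..Z} (\<lambda>z. case (a, z) of (a, z) \<Rightarrow> occupation_sum q 0 a z)"
      using a by (intro continuous_on_compose2[OF cont] continuous_intros) auto
    then show "continuous_on {0..Z} (occupation_sum q 0 a)" by simp
  qed (use a zero m Z upper in auto)
  then obtain \<zeta> where \<zeta>: "\<And>a. a \<in> {b..c} \<Longrightarrow> 0 \<le> \<zeta> a \<and> \<zeta> a \<le> Z \<and> occupation_sum q 0 a (\<zeta> a) = m"
    by metis
  have unique: "z = \<zeta> a" if "a \<in> {b..c}" "0 \<le> z" "occupation_sum q 0 a z = m" for a z
    using that \<zeta>[of a] b q occupation_sum_strict_mono[of q 0 a z "\<zeta> a"]
      occupation_sum_strict_mono[of q 0 a "\<zeta> a" z] by (cases z "\<zeta> a" rule: linorder_cases) auto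
  \<comment> \<open>By uniqueness this level set is exactly the graph of
    \<open>\<zeta>\<close>.\<close>
  have "closed {x \<in> ?S. (case x of (a, z) \<Rightarrow> occupation_sum q 0 a z) = m}"
    by (intro continuous_closed_preimage_constant cont closed_Times) auto
  also have "{x \<in> ?S. (case x of (a, z) \<Rightarrow> occupation_sum q 0 a z) = m} = (\<lambda>a. (a, \<zeta> a)) ` {b..c}"
    using \<zeta> unique by (auto simp: image_iff)
  finally have "continuous_on {b..c} \<zeta>"
    using \<zeta> by (intro continuous_from_closed_graph[of "{0..Z}"]) auto
  moreover have "0 < \<zeta> a \<and> \<zeta> a \<le> Z \<and> occupation_sum q 0 a (\<zeta> a) = m" if "b \<le> a" "a \<le> c" for a
    using \<zeta>[of a] zero[of a] m that by (cases "\<zeta> a = 0") auto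
  ultimately show thesis by (rule that)
qed

text \<open>The constants depend only on \<open>q\<close> and \<open>m0\<close>, so the estimates
  hold uniformly along any family with \<open>m\<close> bounded below.\<close>

lemma calibration_solution:
  assumes q: "1 \<le> q" and m0: "0 < m0"
  obtains C h0 where "0 < h0" and
    "\<And>n m. 0 < n \<Longrightarrow> m0 \<le> m \<Longrightarrow> root q (m ^ (q + 1) / n) \<le> h0 \<Longrightarrow>
      \<exists>a z. 0 < a \<and> 0 < z \<and> occupation_sum q 0 a z = m \<and> occupation_sum q 1 a z = n \<and>
        \<bar>real q * a * n / m - 1\<bar> \<le> C * root q (m ^ (q + 1) / n) \<and>
        \<bar>z * (root q q * Gamma (1 + 1 / real q)) / root q (m ^ (q + 1) / n) - 1\<bar>
          \<le> C * root q (m ^ (q + 1) / n)"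
proof -
  define G where "G = Gamma (1 + 1 / real q)"
  have G: "0 < G" unfolding G_def by (intro Gamma_real_pos) (simp add: add_pos_nonneg)
  obtain K where K: "0 < K" and est:
    "\<And>a z. 0 < a \<Longrightarrow> 0 < z \<Longrightarrow> K * (root q a + z) \<le> 1 \<Longrightarrow>
      \<bar>occupation_sum q 0 a z * root q a / (G * z) - 1\<bar> \<le> K * (root q a + z) \<and>
      \<bar>real q * a * occupation_sum q 1 a z / occupation_sum q 0 a z - 1\<bar> \<le> K * (root q a + z)"
    unfolding G_def by (rule calibration_estimates[OF q]) blast
  \<comment> \<open>Chosen so that \<open>root q a + z \<le> D * h\<close> for all \<open>a\<close>
    and \<open>z\<close> considered: the first summand bounds \<open>root q a\<close>, the second
    \<open>z\<close>.\<close>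
  define D where "D = 2 / m0 + 4 / G"
  have D: "0 < D" using m0 G by (simp add: D_def add_pos_pos)
  show thesis
  \<comment> \<open>The threshold keeps every relative error \<open>K * (D * h)\<close> at most
    \<open>1 / 2\<close>; the 4 comes from the final quotient of two such quantities.\<close>
  proof (rule that[of "1 / (2 * K * D)" "4 * K * D"])
    show "0 < 1 / (2 * K * D)" using K D by simp
    fix n m :: real
    assume n: "0 < n" and "m0 \<le> m" and h0: "root q (m ^ (q + 1) / n) \<le> 1 / (2 * K * D)"
    with m0 have m: "m0 \<le> m" "0 < m" by auto
    define h where "h = root q (m ^ (q + 1) / n)"
    have h: "0 < h" using q m n by (simp add: h_def)
    have hq: "h ^ q = m ^ (q + 1) / n" using q m n by (simp add: h_def)
    have KDh: "K * (D * h) \<le> 1 / 2"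
      using h0 K D unfolding h_def[symmetric] by (simp add: field_simps)
    \<comment> \<open>Half and twice the predicted value \<open>m / (q * n)\<close> of
      \<open>a\<close>.\<close>
    define b c where "b = m / (2 * real q * n)" and "c = 2 * m / (real q * n)"
    have b: "0 < b" "b \<le> c" using m n q by (auto simp: b_def c_def field_simps)
    have u: "root q a * m \<le> 2 * h" "root q a \<le> 2 / m0 * h" if a: "b \<le> a" "a \<le> c" for a
    proof -
      have a0: "0 < a" using a b by simp
      have "(root q a * m) ^ q = a * m ^ q" using q a0 by (simp add: power_mult_distrib)
      also have "\<dots> \<le> c * m ^ q" using a m by (intro mult_right_mono) auto
      also have "\<dots> = 2 / real q * h ^ q" by (simp add: c_def hq)
      also have "\<dots> \<le> 2 ^ q * h ^ q"
      proof (intro mult_right_mono)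
        have "2 / real q \<le> 2" using q by (simp add: divide_le_eq)
        also have "(2::real) \<le> 2 ^ q" using q self_le_power[of "2::real" q] by simp
        finally show "2 / real q \<le> 2 ^ q" .
      qed (use h in simp)
      finally have "(root q a * m) ^ q \<le> (2 * h) ^ q" by (simp add: power_mult_distrib)
      then show *: "root q a * m \<le> 2 * h"
        using q h a0 m by (subst (asm) power_mono_iff) auto
      \<comment> \<open>Here the lower bound on \<open>m\<close> makes \<open>root q a\<close>
        itself of order \<open>h\<close>.\<close>
      have "root q a * m0 \<le> root q a * m" using a0 q m by (intro mult_left_mono) auto
      with * show "root q a \<le> 2 / m0 * h" using m0 by (simp add: field_simps)
    qed
    \<comment> \<open>With relative error at most \<open>1 / 2\<close>, this \<open>Z\<close> gives
      mean length times \<open>root q a\<close> at least \<open>G * Z / 2 = 2 * h\<close>, which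
      dominates \<open>m * root q a\<close>.\<close>
    define Z where "Z = 4 / G * h"
    have Z: "0 < Z" using G h by (simp add: Z_def)
    have small: "K * (root q a + z) \<le> K * (D * h)" if "b \<le> a" "a \<le> c" "z \<le> Z" for a z
      using u(2)[OF that(1,2)] that(3) K by (simp add: D_def Z_def distrib_right)
    have "m \<le> occupation_sum q 0 a Z" if a: "b \<le> a" "a \<le> c" for a
    proof -
      have a0: "0 < a" and u0: "0 < root q a" using a b q by auto
      have "K * (root q a + Z) \<le> 1 / 2" using small[OF a order_refl] KDh by simp
      then have "1 / 2 \<le> occupation_sum q 0 a Z * root q a / (G * Z)"
        using est[OF a0 Z] by linarith
      then have "G * Z / 2 \<le> occupation_sum q 0 a Z * root q a"
        using G Z by (simp add: field_simps)
      moreover have "G * Z / 2 = 2 * h" using G by (simp add: Z_def)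
      ultimately have "m * root q a \<le> occupation_sum q 0 a Z * root q a"
        using u(1)[OF a] by (simp add: mult.commute)
      then show ?thesis using u0 by simp
    qed
    then obtain \<zeta> where cont: "continuous_on {b..c} \<zeta>" and \<zeta>:
      "\<And>a. b \<le> a \<Longrightarrow> a \<le> c \<Longrightarrow> 0 < \<zeta> a \<and> \<zeta> a \<le> Z \<and> occupation_sum q 0 a (\<zeta> a) = m"
      by (rule calibration_implicit_solution[OF q b(1) m(2) Z]) blast+
    have est': "\<bar>m * root q a / (G * \<zeta> a) - 1\<bar> \<le> K * (D * h)"
      "\<bar>real q * a * occupation_sum q 1 a (\<zeta> a) / m - 1\<bar> \<le> K * (D * h)" if a: "b \<le> a" "a \<le> c" for a
    proof -
      have "K * (root q a + \<zeta> a) \<le> K * (D * h)" using small a \<zeta>[OF a] by blast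
      then show "\<bar>m * root q a / (G * \<zeta> a) - 1\<bar> \<le> K * (D * h)"
        "\<bar>real q * a * occupation_sum q 1 a (\<zeta> a) / m - 1\<bar> \<le> K * (D * h)"
        using est[of a "\<zeta> a"] KDh a b \<zeta>[OF a] by auto
    qed
    have "\<exists>a\<ge>b. a \<le> c \<and> occupation_sum q 1 a (\<zeta> a) = n"
    \<comment> \<open>At \<open>b\<close> and \<open>c\<close> the prediction for the mean weight is
      \<open>2 * n\<close> and \<open>n / 2\<close>; an error of at most \<open>1 / 2\<close> cannot
      carry either across \<open>n\<close>.\<close>
    proof (rule IVT2')
      have e: "real q * b * y / m = y / (2 * n)" "real q * c * y / m = 2 * y / n" for y
        using q m n by (simp_all add: b_def c_def)
      have "1 / 2 \<le> occupation_sum q 1 b (\<zeta> b) / (2 * n)"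
        using est'(2)[OF order_refl b(2)] KDh unfolding e by linarith
      then show "n \<le> occupation_sum q 1 b (\<zeta> b)" using n by (simp add: field_simps)
      have "2 * occupation_sum q 1 c (\<zeta> c) / n \<le> 2"
        using est'(2)[OF b(2) order_refl] KDh unfolding e by linarith
      then show "occupation_sum q 1 c (\<zeta> c) \<le> n" using n by (simp add: field_simps)
      have "continuous_on {b..c} (\<lambda>a. case (a, \<zeta> a) of (a, z) \<Rightarrow> occupation_sum q 1 a z)"
        using \<zeta> q b Z by (intro continuous_on_compose2[OF continuous_on_occupation_sum[of q 1 b Z c]]
          continuous_intros cont) (auto simp: less_imp_le)
      then show "continuous_on {b..c} (\<lambda>a. occupation_sum q 1 a (\<zeta> a))" by simp
    qed (rule b)
    then obtain a where a: "b \<le> a" "a \<le> c" and an: "occupation_sum q 1 a (\<zeta> a) = n" by blast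
    have a0: "0 < a" using a b by simp
    have z0: "0 < \<zeta> a" and am: "occupation_sum q 0 a (\<zeta> a) = m" using \<zeta>[OF a] by auto
    \<comment> \<open>The \<open>q\<close>-th root of \<open>q * a * n / m\<close>. Dividing it by
      the normalized second equation eliminates \<open>root q a\<close> and leaves the ratio of
      \<open>\<zeta> a\<close> to its predicted value.\<close>
    define r where "r = root q q * root q a * m / h"
    have r0: "0 \<le> r" using a0 m h q by (simp add: r_def)
    have "r ^ q = real q * a * m ^ q / h ^ q"
      using q a0 by (simp add: r_def power_mult_distrib power_divide)
    also have "\<dots> = real q * a * n / m" using m n by (simp add: hq)
    finally have rq: "r ^ q = real q * a * n / m" .
    have 1: "\<bar>real q * a * n / m - 1\<bar> \<le> K * (D * h)"
      using est'(2)[OF a] unfolding an .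
    with abs_minus_one_le_power[OF r0 q] have "\<bar>r - 1\<bar> \<le> K * (D * h)" by (simp add: rq)
    with est'(1)[OF a] KDh have "\<bar>r / (m * root q a / (G * \<zeta> a)) - 1\<bar> \<le> 2 * (K * (D * h) + K * (D * h))"
      by (intro abs_quotient_minus_one_le)
    moreover have "r / (m * root q a / (G * \<zeta> a)) = \<zeta> a * (root q q * G) / h"
      using m a0 q by (simp add: r_def)
    ultimately have 2: "\<bar>\<zeta> a * (root q q * G) / h - 1\<bar> \<le> 4 * K * D * h" by (simp add: mult_ac)
    have "1 * (K * (D * h)) \<le> 4 * (K * (D * h))"
      using K D h by (intro mult_right_mono) auto
    then have "K * (D * h) \<le> 4 * K * D * h" by (simp only: mult.assoc mult_1_left)
    with 1 have "\<bar>real q * a * n / m - 1\<bar> \<le> 4 * K * D * h" by (rule order_trans)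
    with 2 show "\<exists>a z. 0 < a \<and> 0 < z \<and> occupation_sum q 0 a z = m \<and> occupation_sum q 1 a z = n \<and>
        \<bar>real q * a * n / m - 1\<bar> \<le> 4 * K * D * root q (m ^ (q + 1) / n) \<and>
        \<bar>z * (root q q * Gamma (1 + 1 / real q)) / root q (m ^ (q + 1) / n) - 1\<bar>
          \<le> 4 * K * D * root q (m ^ (q + 1) / n)"
      using a0 z0 am an unfolding h_def G_def by blast
  qed
qed

text \<open>Eventual existence and uniqueness keep the asymptotic claim from being vacuous. Any
  family of roots eventually coincides with the constructed one and inherits its error
  bounds.\<close>

theorem theorem3p7:
  fixes q :: nat and F :: "'a filter" and N M \<kappa> :: "'a \<Rightarrow> real"
  assumes q: "1 \<le> q"
    and N_pos: "\<And>t. 0 < N t"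
    and M_pos: "\<And>t. 0 < M t"
    and N_lim: "filterlim N at_top F"
    and M_bound: "(\<lambda>t. inverse (M t)) \<in> O[F](\<lambda>_. 1)"
    and \<kappa>_def: "\<And>t. \<kappa> t = M t ^ (q + 1) / N t"
    and \<kappa>_lim: "(\<kappa> \<longlongrightarrow> 0) F"
  shows "(\<forall>\<^sub>F t in F. \<exists>!z. calibration_root q (N t) (M t) z) \<and>
    (\<forall>z1 z2 :: 'a \<Rightarrow> real.
       (\<forall>\<^sub>F t in F. calibration_root q (N t) (M t) (z1 t, z2 t)) \<longrightarrow>
       (\<exists>\<epsilon>1 \<epsilon>2.
          \<epsilon>1 \<in> O[F](\<lambda>t. \<kappa> t powr (1 / real q)) \<and>
          \<epsilon>2 \<in> O[F](\<lambda>t. \<kappa> t powr (1 / real q)) \<and>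
          (\<forall>\<^sub>F t in F.
             z1 t = exp (- (M t / (real q * N t)) * (1 + \<epsilon>1 t)) \<and>
             z2 t = \<kappa> t powr (1 / real q) / (real q powr (1 / real q) * Gamma (1 + 1 / real q))
                      * (1 + \<epsilon>2 t))))"
proof -
  define G where "G = Gamma (1 + 1 / real q)"
  have G: "0 < G" unfolding G_def by (intro Gamma_real_pos) (simp add: add_pos_nonneg)
  define h where "h = (\<lambda>t. root q (\<kappa> t))"
  have \<kappa>0: "0 < \<kappa> t" for t using M_pos N_pos by (simp add: \<kappa>_def)
  have h_powr: "\<kappa> t powr (1 / real q) = h t" for t
    using \<kappa>0[of t] q by (simp add: h_def root_powr_inverse)
  have q_powr: "real q powr (1 / real q) = root q q"
    using q by (simp add: root_powr_inverse)
  have h0: "0 < h t" for t using \<kappa>0 q by (simp add: h_def)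
  obtain c where c: "0 < c" "\<forall>\<^sub>F t in F. norm (inverse (M t)) \<le> c * norm (1::real)"
    using M_bound by (rule landau_o.bigE)
  obtain C h1 where h1: "0 < h1" and solution:
    "\<And>n m. 0 < n \<Longrightarrow> 1 / c \<le> m \<Longrightarrow> root q (m ^ (q + 1) / n) \<le> h1 \<Longrightarrow>
      \<exists>a z. 0 < a \<and> 0 < z \<and> occupation_sum q 0 a z = m \<and> occupation_sum q 1 a z = n \<and>
        \<bar>real q * a * n / m - 1\<bar> \<le> C * root q (m ^ (q + 1) / n) \<and>
        \<bar>z * (root q q * Gamma (1 + 1 / real q)) / root q (m ^ (q + 1) / n) - 1\<bar>
          \<le> C * root q (m ^ (q + 1) / n)"
    using c by (rule_tac calibration_solution[OF q, of "1 / c"]) auto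
  have M_ge: "\<forall>\<^sub>F t in F. 1 / c \<le> M t"
    using c(2)
  proof eventually_elim
    case (elim t)
    then show ?case using M_pos[of t] c(1) by (simp add: field_simps)
  qed
  have "(h \<longlongrightarrow> root q 0) F"
    unfolding h_def by (intro tendsto_intros \<kappa>_lim)
  then have h_le: "\<forall>\<^sub>F t in F. h t \<le> h1"
    using h1 by (auto dest!: order_tendstoD(2)[of _ _ _ h1] elim: eventually_mono)
  have root_ex: "\<forall>\<^sub>F t in F. \<exists>w1 w2. calibration_root q (N t) (M t) (w1, w2) \<and>
      \<bar>real q * (- ln w1) * N t / M t - 1\<bar> \<le> C * h t \<and> \<bar>w2 * (root q q * G) / h t - 1\<bar> \<le> C * h t"
    using M_ge h_le
  proof eventually_elim
    case (elim t)
    then obtain a z where "0 < a" "0 < z" "occupation_sum q 0 a z = M t" "occupation_sum q 1 a z = N t"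
      "\<bar>real q * a * N t / M t - 1\<bar> \<le> C * h t" "\<bar>z * (root q q * G) / h t - 1\<bar> \<le> C * h t"
      using solution[of "N t" "M t"] N_pos[of t] unfolding h_def \<kappa>_def G_def by blast
    then show ?case
      by (intro exI[of _ "exp (- a)"] exI[of _ z])
         (simp add: calibration_root_iff_occupation_sum[OF q])
  qed
  have root_unique: "w = z" if "calibration_root q n m w" "calibration_root q n m z" for n m w z
  proof -
    obtain w1 w2 y1 y2 where eq: "w = (w1, w2)" "z = (y1, y2)" by (cases w, cases z)
    have "- ln w1 = - ln y1 \<and> w2 = y2"
      using that unfolding eq calibration_root_iff_occupation_sum[OF q]
      by (intro occupation_sum_inj[OF q]) auto
    then show ?thesis
      using that unfolding eq calibration_root_iff_occupation_sum[OF q] by auto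
  qed
  show ?thesis
  proof (intro conjI allI impI)
    show "\<forall>\<^sub>F t in F. \<exists>!z. calibration_root q (N t) (M t) z"
      using root_ex by eventually_elim (use root_unique in blast)
    fix z1 z2 :: "'a \<Rightarrow> real"
    assume roots: "\<forall>\<^sub>F t in F. calibration_root q (N t) (M t) (z1 t, z2 t)"
    \<comment> \<open>Both error terms are obtained by solving the claimed formulas for them, so
      only their size remains to be shown.\<close>
    define \<epsilon>1 where "\<epsilon>1 = (\<lambda>t. real q * (- ln (z1 t)) * N t / M t - 1)"
    define \<epsilon>2 where "\<epsilon>2 = (\<lambda>t. z2 t * (root q q * G) / h t - 1)"
    have bounds: "\<forall>\<^sub>F t in F. \<bar>\<epsilon>1 t\<bar> \<le> C * h t \<and> \<bar>\<epsilon>2 t\<bar> \<le> C * h t"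
      using root_ex roots
    proof eventually_elim
      case (elim t)
      then show ?case unfolding \<epsilon>1_def \<epsilon>2_def using root_unique by blast
    qed
    have "\<epsilon>1 \<in> O[F](h)" "\<epsilon>2 \<in> O[F](h)"
      using bounds h0 by (auto intro!: bigoI[of _ C] elim!: eventually_mono simp: less_imp_le)
    moreover have "\<forall>\<^sub>F t in F. z1 t = exp (- (M t / (real q * N t)) * (1 + \<epsilon>1 t)) \<and>
        z2 t = h t / (root q q * G) * (1 + \<epsilon>2 t)"
      using roots
    proof eventually_elim
      case (elim t)
      then have "0 < z1 t" by (simp add: calibration_root_def)
      moreover have "- (M t / (real q * N t)) * (1 + \<epsilon>1 t) = ln (z1 t)"
        using q N_pos[of t] M_pos[of t] by (simp add: \<epsilon>1_def)
      ultimately show ?case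
        using q G h0[of t] by (simp add: \<epsilon>2_def)
    qed
    ultimately show "\<exists>\<epsilon>1 \<epsilon>2.
          \<epsilon>1 \<in> O[F](\<lambda>t. \<kappa> t powr (1 / real q)) \<and>
          \<epsilon>2 \<in> O[F](\<lambda>t. \<kappa> t powr (1 / real q)) \<and>
          (\<forall>\<^sub>F t in F.
             z1 t = exp (- (M t / (real q * N t)) * (1 + \<epsilon>1 t)) \<and>
             z2 t = \<kappa> t powr (1 / real q) / (real q powr (1 / real q) * Gamma (1 + 1 / real q))
                      * (1 + \<epsilon>2 t))"
      unfolding h_powr q_powr G_def[symmetric] by blast
  qed
qed

end
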